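(* Let $\mathbf{X}\in\mathbb{R}^{n\times p}$ be a data matrix with rows $\mathbf{x}_1^T,\dots,\mathbf{x}_n^T$, let $\mathbf{y}=(y_1,\dots,y_n)^T\in\mathbb{R}^n$, and let $\mathbf{P}(\boldsymbol{\beta};\lambda)=\sum_{j=1}^p \mathbf{P}(\beta_j;\lambda)$ be a (real-valued, coordinatewise separable) penalty function of $\boldsymbol{\beta}\in\mathbb{R}^p$ with parameter $\lambda$. Put $\mathbf{S}_{xx}=\frac1n\sum_{i=1}^n\mathbf{x}_i\mathbf{x}_i^T$ and $\mathbf{S}_{xy}=\frac1n\sum_{i=1}^n y_i\mathbf{x}_i$. Then the penalized regression problem $$\min_{\boldsymbol{\beta}\in\mathbb{R}^p}\ \frac{1}{2n}\|\mathbf{y}-\mathbf{X}\boldsymbol{\beta}\|^2+\mathbf{P}(\boldsymbol{\beta};\lambda)$$ is equivalent to the problem $$\min_{\boldsymbol{\beta}\in\mathbb{R}^p}\ \frac12\boldsymbol{\beta}^T\mathbf{S}_{xx}\boldsymbol{\beta}-\boldsymbol{\beta}^T\mathbf{S}_{xy}+\mathbf{P}(\boldsymbol{\beta};\lambda),$$ i.e. a vector $\boldsymbol{\beta}\in\mathbb{R}^p$ is a minimizer of the first problem if and only if it is a minimizer of the second.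
   Context: $\|\cdot\|$ is the Euclidean norm. The quantities $\mathbf{S}_{xx},\mathbf{S}_{xy}$ are called running averages. Two minimization problems are called equivalent when they have the same minimizers. *)

theory Defs
  imports "HOL-Analysis.Analysis"
begin

text \<open>A data matrix with \<open>n\<close> rows and \<open>p\<close> columns is \<open>X :: real ^ 'p ^ 'n\<close>, where
  \<open>n = CARD('n)\<close> and \<open>p = CARD('p)\<close>; the observation \<open>x_i\<close> is \<open>row i X\<close>.\<close>

text \<open>The matrix \<open>u v\<^sup>T\<close>.\<close>
definition outer_product :: "real ^ 'm \<Rightarrow> real ^ 'k \<Rightarrow> real ^ 'k ^ 'm" where
  "outer_product u v = (\<chi> i j. u $ i * v $ j)"

definition S_xx :: "real ^ 'p ^ 'n \<Rightarrow> real ^ 'p ^ 'p" where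
  "S_xx X = (1 / real CARD('n)) *\<^sub>R (\<Sum>i\<in>UNIV. outer_product (row i X) (row i X))"

definition S_xy :: "real ^ 'p ^ 'n \<Rightarrow> real ^ 'n \<Rightarrow> real ^ 'p" where
  "S_xy X y = (1 / real CARD('n)) *\<^sub>R (\<Sum>i\<in>UNIV. y $ i *\<^sub>R row i X)"

text \<open>\<open>P\<close> is the scalar penalty. The parameter \<open>lam\<close> has an arbitrary type, so it may be a real
  number or a tuple of tuning parameters.\<close>
definition penalty :: "(real \<Rightarrow> 'l \<Rightarrow> real) \<Rightarrow> real ^ 'p \<Rightarrow> 'l \<Rightarrow> real" where
  "penalty P \<beta> lam = (\<Sum>j\<in>UNIV. P (\<beta> $ j) lam)"

definition penalized_regression_objective ::
  "real ^ 'p ^ 'n \<Rightarrow> real ^ 'n \<Rightarrow> (real \<Rightarrow> 'l \<Rightarrow> real) \<Rightarrow> 'l \<Rightarrow> real ^ 'p \<Rightarrow> real" where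
  "penalized_regression_objective X y P lam \<beta> =
     1 / (2 * real CARD('n)) * (norm (y - X *v \<beta>))\<^sup>2 + penalty P \<beta> lam"

definition running_average_objective ::
  "real ^ 'p ^ 'n \<Rightarrow> real ^ 'n \<Rightarrow> (real \<Rightarrow> 'l \<Rightarrow> real) \<Rightarrow> 'l \<Rightarrow> real ^ 'p \<Rightarrow> real" where
  "running_average_objective X y P lam \<beta> =
     1 / 2 * (\<beta> \<bullet> (S_xx X *v \<beta>)) - \<beta> \<bullet> S_xy X y + penalty P \<beta> lam"

text \<open>Unconstrained problems \<open>min f\<close> and \<open>min g\<close> are equivalent when they have the same global
  minimizers; neither is required to have one.\<close>
definition equivalent_min_problems :: "('a \<Rightarrow> real) \<Rightarrow> ('a \<Rightarrow> real) \<Rightarrow> bool" where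
  "equivalent_min_problems f g \<longleftrightarrow>
     (\<forall>x. is_arg_min f (\<lambda>_. True) x \<longleftrightarrow> is_arg_min g (\<lambda>_. True) x)"

end

theory Submission
  imports Defs
begin

text \<open>The data meet \<open>X *v \<beta>\<close> only through its squared norm and its inner
  product with \<open>y\<close>; \<open>S_xx_quadratic_form\<close> and \<open>inner_S_xy\<close>
  express these by the running averages. What remains is a constant, and adding a constant moves no
  minimizer, whatever the penalty.\<close>

text \<open>Expanding the square shows that the two objectives differ by \<open>\<parallel>y\<parallel>\<^sup>2 / (2n)\<close>, which does
  not depend on \<open>\<beta>\<close>.\<close>

lemma outer_product_mult_vector: "outer_product u v *v w = (v \<bullet> w) *\<^sub>R u"
  by (simp add: vec_eq_iff outer_product_def matrix_vector_mult_def inner_vec_def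
      sum_distrib_left mult_ac)

lemma sum_matrix_vector_mult: "(\<Sum>i\<in>I. A i) *v x = (\<Sum>i\<in>I. A i *v x)"
  for A :: "'i \<Rightarrow> real ^ 'n ^ 'm"
  by (induction I rule: infinite_finite_induct) (simp_all add: matrix_vector_mult_add_rdistrib)

text \<open>The i-th summand of \<open>S_xx\<close> sends \<open>\<beta>\<close> to a multiple of
  row i; pairing with \<open>\<beta>\<close> gives the square of entry i of
  \<open>X *v \<beta>\<close>.\<close>

lemma S_xx_quadratic_form:
  fixes X :: "real ^ 'p ^ 'n"
  shows "\<beta> \<bullet> (S_xx X *v \<beta>) = (norm (X *v \<beta>))\<^sup>2 / real CARD('n)"
proof -
  have "(norm (X *v \<beta>))\<^sup>2 = (\<Sum>i\<in>UNIV. (row i X \<bullet> \<beta>)\<^sup>2)"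
    \<comment> \<open>The instance expands only the outer inner product, leaving each
      \<open>row i X \<bullet> \<beta>\<close> whole.\<close>
    unfolding power2_norm_eq_inner inner_vec_def[of "X *v \<beta>"]
    by (simp add: matrix_vector_mul_component row_def power2_eq_square)
  then show ?thesis
    by (simp add: S_xx_def scaleR_matrix_vector_assoc[symmetric] sum_matrix_vector_mult
        outer_product_mult_vector inner_sum_right inner_commute power2_eq_square)
qed

lemma inner_S_xy:
  fixes X :: "real ^ 'p ^ 'n"
  shows "\<beta> \<bullet> S_xy X y = (y \<bullet> (X *v \<beta>)) / real CARD('n)"
  unfolding inner_vec_def[of y]
  by (simp add: S_xy_def inner_sum_right matrix_vector_mul_component row_def inner_commute)

lemma penalized_regression_objective_eq:
  fixes X :: "real ^ 'p ^ 'n"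
  shows "penalized_regression_objective X y P lam \<beta> =
    running_average_objective X y P lam \<beta> + (norm y)\<^sup>2 / (2 * real CARD('n))"
proof -
  have "(norm (y - X *v \<beta>))\<^sup>2 = (norm y)\<^sup>2 - 2 * (y \<bullet> (X *v \<beta>)) + (norm (X *v \<beta>))\<^sup>2"
    by (simp add: power2_norm_eq_inner inner_diff_left inner_diff_right inner_commute)
  then show ?thesis
    by (simp add: penalized_regression_objective_def running_average_objective_def
        S_xx_quadratic_form inner_S_xy field_simps)
qed

theorem proposition3p1:
  fixes X :: "real ^ 'p ^ 'n" and y :: "real ^ 'n"
    and P :: "real \<Rightarrow> 'l \<Rightarrow> real" and lam :: 'l
  shows "equivalent_min_problems
           (penalized_regression_objective X y P lam)
           (running_average_objective X y P lam)"
  \<comment> \<open>\<open>is_arg_min\<close> compares values only by strict inequality, so the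
    shared constant cancels.\<close>
  by (simp add: equivalent_min_problems_def is_arg_min_def penalized_regression_objective_eq)

end
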